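(* Let $k$ and $n$ be positive integers and let $s$ be an even positive integer with $n\ge (s+2)k-2$, and let $t=n-s(k-1)$. Any proper coloring of $\operatorname{KG}_s(n,k)$ contains a complete bipartite subgraph $K_{\lfloor t/2\rfloor,\lceil t/2\rceil}$ all of whose $t$ vertices receive pairwise different colors, and these colors occur alternating on the two parts with respect to their natural order (if the colors are $i_1<\dots<i_t$, one part receives exactly $\{i_j: j \text{ odd}\}$ and the other exactly $\{i_j: j\text{ even}\}$). In particular, $\chi(\operatorname{KG}_s(n,k))=n-s(k-1)$.
   Context: $[n]=\{1,\dots,n\}$. A nonempty subset $\mathcal{S}\subseteq[n]$ is $s$-stable if for any two different $i,j\in\mathcal{S}$, $s\le|i-j|\le n-s$. The $s$-stable Kneser graph $\operatorname{KG}_s(n,k)$ has as vertices all $s$-stable $k$-subsets of $[n]$, two vertices adjacent iff the subsets are disjoint. Colors are positive integers. *)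

theory Defs
  imports "Graph_Theory.Kuratowski"
begin

text \<open>
  The differences are taken over the integers, so that neither \<open>i - j\<close> nor \<open>n - s\<close> is truncated.
\<close>

definition s_stable :: "nat \<Rightarrow> nat \<Rightarrow> nat set \<Rightarrow> bool" where
  "s_stable s n S \<longleftrightarrow> S \<noteq> {} \<and> S \<subseteq> {1..n} \<and>
     (\<forall>i\<in>S. \<forall>j\<in>S. i \<noteq> j \<longrightarrow>
        int s \<le> \<bar>int i - int j\<bar> \<and> \<bar>int i - int j\<bar> \<le> int n - int s)"

text \<open>Undirected graphs are symmetric digraphs, as everywhere in the graph library.\<close>

definition stable_kneser_graph :: "nat \<Rightarrow> nat \<Rightarrow> nat \<Rightarrow> nat set pair_pre_digraph" where
  "stable_kneser_graph s n k =
     (let V = {S. s_stable s n S \<and> card S = k}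
      in \<lparr> pverts = V, parcs = {(S, T). S \<in> V \<and> T \<in> V \<and> S \<inter> T = {}} \<rparr>)"

lemma pair_graph_stable_kneser_graph: "pair_graph (stable_kneser_graph s n k)"
proof -
  let ?G = "stable_kneser_graph s n k"
  have V: "finite (pverts ?G)"
    by (rule finite_subset[of _ "Pow {1..n}"])
      (auto simp: stable_kneser_graph_def s_stable_def)
  have "finite (parcs ?G)"
    by (rule finite_subset[OF _ finite_cartesian_product[OF V V]])
      (auto simp: stable_kneser_graph_def)
  moreover have "symmetric (with_proj ?G)"
    unfolding symmetric_def with_proj_simps
    by (rule symI) (simp add: stable_kneser_graph_def Let_def Int_commute)
  moreover have "fst e \<in> pverts ?G \<and> snd e \<in> pverts ?G \<and> fst e \<noteq> snd e"
    if "e \<in> parcs ?G" for e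
  proof (cases e)
    case (Pair S T)
    with that have "s_stable s n S" "card S = k" "s_stable s n T" "card T = k" "S \<inter> T = {}"
      by (simp_all add: stable_kneser_graph_def Let_def)
    moreover from this have "S \<noteq> T"
      by (auto simp: s_stable_def)
    ultimately show ?thesis
      using Pair by (simp add: stable_kneser_graph_def Let_def)
  qed
  ultimately show ?thesis
    using V by unfold_locales blast+
qed

definition proper_coloring :: "('a, 'b) pre_digraph \<Rightarrow> ('a \<Rightarrow> nat) \<Rightarrow> bool" where
  "proper_coloring G c \<longleftrightarrow>
     (\<forall>v\<in>verts G. 0 < c v) \<and> (\<forall>u v. u \<rightarrow>\<^bsub>G\<^esub> v \<longrightarrow> c u \<noteq> c v)"

text \<open>Only meaningful if some finite proper coloring exists, e.g. for finite loopfree graphs.\<close>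

definition chromatic_number :: "('a, 'b) pre_digraph \<Rightarrow> nat" where
  "chromatic_number G = (LEAST m. \<exists>c. proper_coloring G c \<and> c ` verts G \<subseteq> {1..m})"

text \<open>
  The predicate \<^const>\<open>complete_bipartite_digraph\<close> hides the two parts; here they are explicit.
\<close>

definition biclique :: "'a set \<Rightarrow> 'a set \<Rightarrow> 'a pair_pre_digraph" where
  "biclique A B = \<lparr> pverts = A \<union> B, parcs = A \<times> B \<union> B \<times> A \<rparr>"

lemma complete_bipartite_biclique:
  assumes "finite A" "finite B" "A \<inter> B = {}"
  shows "complete_bipartite_digraph (card A) (card B) (with_proj (biclique A B))"
  using assms by (auto simp: complete_bipartite_digraph_pair_def biclique_def)

text \<open>
  The increasing enumeration \<open>i\<close> is indexed by \<open>1, \<dots>, t\<close>; it is uniquely determined on this range.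
\<close>

definition alternating_parts :: "nat \<Rightarrow> nat set \<Rightarrow> nat set \<Rightarrow> bool" where
  "alternating_parts t X Y \<longleftrightarrow>
     (\<exists>i. strict_mono_on {1..t} i \<and> i ` {1..t} = X \<union> Y \<and>
        (let Od = i ` {j \<in> {1..t}. odd j}; Ev = i ` {j \<in> {1..t}. even j}
         in X = Od \<and> Y = Ev \<or> X = Ev \<and> Y = Od))"

end

theory Submission
  imports Defs
begin

text \<open>
  Write \<open>s = 2 h\<close> and \<open>K = h (k - 1) + 1\<close>, so that \<open>t = n - 2 K + 2\<close>. A greedy walk around the circle
  shows that, for \<open>n \<ge> (s + 2) k - 2\<close>, every \<open>2\<close>-stable \<open>K\<close>-subset of \<open>[n]\<close> contains an \<open>s\<close>-stable
  \<open>k\<close>-subset; hence a signed set with an alternating subsequence of length \<open>2 K\<close> contains \<open>s\<close>-stable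
  \<open>k\<close>-subsets of both signs. Assign to a signed set the length of its longest alternating subsequence
  and the first sign of that sequence if this length is below \<open>2 K\<close>, and otherwise \<open>2 K - 1\<close> plus the
  largest colour of an \<open>s\<close>-stable \<open>k\<close>-subset of either sign, with that sign. This level is monotone, and
  nested signed sets of equal level have equal signs. By Ky Fan's parity argument some maximal chain
  of signed sets has alternating signs; along it the level increases strictly, so at least
  \<open>n - 2 K + 1 = t - 1\<close> of its members have increasing colours on alternating signs.
\<close>

section \<open>Ky Fan's parity count\<close>

lemma even_card_involution:
  assumes "finite S" "\<And>x. x \<in> S \<Longrightarrow> f x \<in> S" "\<And>x. x \<in> S \<Longrightarrow> f x \<noteq> x" "\<And>x. x \<in> S \<Longrightarrow> f (f x) = x"
  shows "even (card S)"
  using assms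
proof (induction "card S" arbitrary: S rule: less_induct)
  case less
  show ?case
  proof (cases "S = {}")
    case False
    then obtain x where x: "x \<in> S" by blast
    let ?T = "S - {x, f x}"
    have c: "card S = card ?T + 2"
    proof -
      have "{x, f x} \<subseteq> S" "card {x, f x} = 2" using x less.prems(2) less.prems(3)[OF x] by auto
      then show ?thesis
        using card_Diff_subset[of "{x, f x}" S] card_mono[OF less.prems(1), of "{x, f x}"] by simp
    qed
    have "f y \<in> ?T" if "y \<in> ?T" for y
    proof -
      have "f (f y) = y" "f (f x) = x" "f y \<in> S" using that x less.prems(2,4) by auto
      then show ?thesis using that by auto
    qed
    then have "even (card ?T)"
      using c less.prems by (intro less.hyps) auto
    then show ?thesis using c by simp
  qed simp
qed

text \<open>With \<open>p j\<close> read as "entry \<open>j\<close> agrees with the alternating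
  pattern", these are the positions whose deletion leaves a sequence that follows the pattern: later
  entries move down by one, so they have to disagree beforehand, while \<open>p i\<close> itself is
  free.\<close>

definition switch_points :: "(nat \<Rightarrow> bool) \<Rightarrow> nat \<Rightarrow> nat set" where
  "switch_points p n = {i. i < n \<and> (\<forall>j<i. p j) \<and> (\<forall>j. i < j \<and> j < n \<longrightarrow> \<not> p j)}"

text \<open>A switch point forces \<open>p\<close> to be a block of true values followed by a block
  of false ones, up to the value at that point. If both blocks are nonempty, exactly the two
  positions at their border qualify; a constant \<open>p\<close> has only its last or its first
  position. The induction appends one value at a time.\<close>

lemma odd_card_switch_points:
  assumes "0 < n"
  shows "odd (card (switch_points p n)) \<longleftrightarrow> (\<forall>j<n. p j) \<or> (\<forall>j<n. \<not> p j)"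
  using assms
proof (induction n rule: nat_induct_non_zero)
  case 1
  have "switch_points p 1 = {0}" by (auto simp: switch_points_def)
  then show ?case by auto
next
  case (Suc n)
  let ?D = "switch_points p"
  have fin: "finite (?D n)" and nn: "n \<notin> ?D n" by (auto simp: switch_points_def)
  consider "p n" "\<forall>j<n. p j" | "p n" "\<not> (\<forall>j<n. p j)"
    | "\<not> p n" "\<forall>j<n. p j" | "\<not> p n" "\<not> (\<forall>j<n. p j)" by auto
  then show ?case
  proof cases
    case 1
    have "?D (Suc n) = {n}" using 1 by (auto simp: switch_points_def less_Suc_eq)
    moreover have "\<forall>j<Suc n. p j" using 1 by (simp add: less_Suc_eq)
    ultimately show ?thesis by simp
  next
    case 2
    have "?D (Suc n) = {}" using 2 by (auto simp: switch_points_def less_Suc_eq)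
    then show ?thesis using 2 by (auto simp: less_Suc_eq)
  next
    case 3
    have "?D (Suc n) = insert n (?D n)" using 3 by (auto simp: switch_points_def less_Suc_eq)
    then have "card (?D (Suc n)) = Suc (card (?D n))" using fin nn by simp
    then show ?thesis using 3 Suc by (auto simp: less_Suc_eq)
  next
    case 4
    have "?D (Suc n) = ?D n" using 4 by (auto simp: switch_points_def less_Suc_eq)
    then show ?thesis using 4 Suc by (auto simp: less_Suc_eq)
  qed
qed

text \<open>A list of signed coordinates encodes the maximal chain of its prefixes in the barycentric
  subdivision of the cross-polytope.\<close>

definition flags :: "nat \<Rightarrow> (nat \<times> bool) list set" where
  "flags n = {w. distinct (map fst w) \<and> fst ` set w = {1..n}}"

section \<open>Signed coordinates, flags and the antipodal map\<close>

definition flip :: "nat \<times> bool \<Rightarrow> nat \<times> bool" where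
  "flip = map_prod id Not"

lemma flip_flip [simp]: "flip (flip x) = x" and fst_flip [simp]: "fst (flip x) = fst x"
  and snd_flip [simp]: "snd (flip x) = (\<not> snd x)"
  by (auto simp: flip_def map_prod_def split: prod.splits)

lemma flip_Pair [simp]: "flip (a, b) = (a, \<not> b)" by (simp add: flip_def)

lemma flip_image_iff: "x \<in> flip ` X \<longleftrightarrow> flip x \<in> X"
proof
  assume "flip x \<in> X"
  then have "flip (flip x) \<in> flip ` X" by (rule imageI)
  then show "x \<in> flip ` X" by simp
qed auto

lemma fst_comp_flip [simp]: "fst \<circ> flip = fst" and flip_comp_flip [simp]: "flip \<circ> flip = id"
  by auto

lemma flip_neq [simp]: "flip x \<noteq> x" by (metis snd_flip)

lemma length_flags:
  assumes "w \<in> flags n"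
  shows "length w = n"
proof -
  have "card (set (map fst w)) = length (map fst w)"
    using assms by (intro distinct_card) (simp add: flags_def)
  then show ?thesis using assms by (simp add: flags_def)
qed

lemma flags_take:
  assumes "w \<in> flags n"
  shows "inj_on fst (set (take i w))" "fst ` set (take i w) \<subseteq> {1..n}"
proof -
  have *: "set (take i w) \<subseteq> set w" by (rule set_take_subset)
  have "inj_on fst (set w)" "fst ` set w = {1..n}"
    using assms by (simp_all add: flags_def distinct_map)
  then show "inj_on fst (set (take i w))" "fst ` set (take i w) \<subseteq> {1..n}"
    using inj_on_subset[OF _ *] image_mono[OF *, of fst] by simp_all
qed

lemma finite_flags: "finite (flags n)"
proof (rule finite_subset)
  show "flags n \<subseteq> {w. set w \<subseteq> {1..n} \<times> UNIV \<and> length w = n}"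
  proof
    fix w assume w: "w \<in> flags n"
    have "set w \<subseteq> fst ` set w \<times> UNIV" by force
    then show "w \<in> {w. set w \<subseteq> {1..n} \<times> UNIV \<and> length w = n}"
      using w length_flags[OF w] by (simp add: flags_def)
  qed
  show "finite {w. set w \<subseteq> {1..n} \<times> (UNIV :: bool set) \<and> length w = n}"
    by (intro finite_lists_length_eq) auto
qed

abbreviation prefix_sign :: "((nat \<times> bool) set \<Rightarrow> bool) \<Rightarrow> (nat \<times> bool) list \<Rightarrow> nat \<Rightarrow> bool" where
  "prefix_sign \<sigma> w i \<equiv> \<sigma> (set (take (Suc i) w))"

text \<open>Double counting of the pairs of a flag of the upper hemisphere and a prefix whose deletion leaves
  the signs alternating: swapping two neighbours of the list, or flipping the last sign, pairs them up
  except for those that come from the equator.\<close>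

lemma odd_card_alternating_flags:
  fixes \<sigma> :: "(nat \<times> bool) set \<Rightarrow> bool"
  assumes "\<And>X. X \<noteq> {} \<Longrightarrow> inj_on fst X \<Longrightarrow> fst ` X \<subseteq> {1..n} \<Longrightarrow> \<sigma> (flip ` X) = (\<not> \<sigma> X)"
  shows "odd (card {w \<in> flags n. \<forall>i<n. prefix_sign \<sigma> w i = even i})"
  using assms
proof (induction n)
  case 0
  have "flags 0 = {[]}" by (auto simp: flags_def)
  then show ?case by simp
next
  case (Suc n)
  define U where "U = {w \<in> flags (Suc n). (Suc n, True) \<in> set w}"
  have finU: "finite U" unfolding U_def using finite_flags by simp
  define p where "p w j \<longleftrightarrow> (prefix_sign \<sigma> w j \<longleftrightarrow> even j)" for w j
  let ?D = "\<lambda>w. switch_points (p w) (Suc n)"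
  define Q where "Q = Sigma U ?D"
  \<comment> \<open>The pairs that stay unmatched: the deleted position is the last one and adds
    \<open>(Suc n, True)\<close>, so all shorter prefixes lie on the equator.\<close>
  define R where "R = {(w, i) \<in> Q. i = n \<and> last w = (Suc n, True)}"
  have finD: "finite (?D w)" for w unfolding switch_points_def by simp
  have finQ: "finite Q" unfolding Q_def using finU finD by simp
  \<comment> \<open>Either move changes only the prefix of length \<open>Suc i\<close>, and the sign
    of that prefix is irrelevant to \<open>i\<close> being a switch point.\<close>
  define g where "g = (\<lambda>(w, i). if i = n then (w[n := flip (w ! n)], i) 
      else (w[i := w ! Suc i, Suc i := w ! i], i::nat))"
  have nd: "i \<in> ?D w'"
    if D: "i \<in> ?D w" and eq: "\<And>j. j \<noteq> i \<Longrightarrow> j < Suc n \<Longrightarrow> set (take (Suc j) w) = set (take (Suc j) w')" for w w' i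
    using D eq unfolding switch_points_def p_def mem_Collect_eq
    by (metis (no_types, lifting) order.strict_trans nat_neq_iff)
  have g: "g x \<in> Q - R \<and> g x \<noteq> x \<and> g (g x) = x" if "x \<in> Q - R" for x
  proof -
    note that
    moreover obtain w i where xw: "x = (w, i)" by fastforce
    ultimately have "(w, i) \<in> Q" "i = n \<Longrightarrow> last w \<noteq> (Suc n, True)" by (auto simp: R_def)
    moreover from this(1) have "i \<in> ?D w" by (simp add: Q_def)
    moreover from this have "i \<le> n" by (simp add: switch_points_def)
    ultimately have x: "x = (w, i)" "w \<in> flags (Suc n)" "(Suc n, True) \<in> set w" "i \<in> ?D w"
       "i \<le> n" "i = n \<Longrightarrow> last w \<noteq> (Suc n, True)"
      using xw by (simp_all add: Q_def U_def)
    have len: "length w = Suc n" using x(2) by (rule length_flags)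
    have dw: "distinct w" using x(2) by (auto simp: flags_def distinct_map)
    have wn: "last w = w ! n" using len by (metis diff_Suc_1 last_conv_nth length_0_conv nat.distinct(1))
    show ?thesis
    proof (cases "i = n")
      case True
      let ?w = "w[n := flip (w ! n)]"
      have m: "map fst ?w = map fst w"
        by (metis fst_flip list_update_id map_update)
      then have "fst ` set ?w = fst ` set w" by (metis set_map)
      with m x have f: "?w \<in> flags (Suc n)" by (simp add: flags_def)
      \<comment> \<open>\<open>(Suc n, True)\<close> occurs in \<open>w\<close>, but not at the end,
        so the flipped sign belongs to another coordinate and the flag stays in
        \<open>U\<close>.\<close>
      have nn: "fst (w ! n) \<noteq> Suc n"
      proof
        assume a: "fst (w ! n) = Suc n"
        have "inj_on fst (set w)" using x(2) by (simp add: flags_def distinct_map)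
        then have "w ! n = (Suc n, True)" using a x(3) len by (metis fst_conv inj_onD lessI nth_mem)
        then show False using x(6)[OF True] wn by simp
      qed
      have mem: "(Suc n, True) \<in> set ?w"
      proof -
        obtain l where "l < Suc n" "w ! l = (Suc n, True)" using x(3) len by (metis in_set_conv_nth)
        moreover from this nn have "l \<noteq> n" by auto
        ultimately show ?thesis using len
          by (metis in_set_conv_nth length_list_update nth_list_update_neq)
      qed
      have "i \<in> ?D ?w" using nd[of i w ?w, OF x(4)] True by (auto simp: less_Suc_eq)
      moreover have "last ?w \<noteq> (Suc n, True)"
        using nn len by (metis fst_conv fst_flip last_list_update length_0_conv nat.distinct(1) diff_Suc_1)
      moreover have "?w \<noteq> w" using len flip_neq by (metis lessI nth_list_update_eq)
      ultimately show ?thesis using x True f mem len by (simp add: g_def Q_def R_def U_def)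
    next
      case False
      then have i: "i < n" using x by simp
      let ?w = "w[i := w ! Suc i, Suc i := w ! i]"
      have ms: "mset ?w = mset w" using i len by (simp add: mset_swap)
      then have s: "set ?w = set w" by (metis mset_eq_setD)
      have "mset (map fst ?w) = mset (map fst w)" using ms by (metis mset_map)
      then have "distinct (map fst ?w)" using x(2) by (metis (mono_tags) flags_def mem_Collect_eq mset_eq_imp_distinct_iff)
      then have f: "?w \<in> flags (Suc n)" using s x by (simp add: flags_def)
      have "set (take (Suc j) w) = set (take (Suc j) ?w)" if "j \<noteq> i" for j
      proof (cases "j < i")
        case True then show ?thesis by simp
      next
        case False
        then have "i < j" using that by simp
        then have "mset ((take (Suc j) w)[i := take (Suc j) w ! Suc i, Suc i := take (Suc j) w ! i]) = mset (take (Suc j) w)"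
          using i len by (intro mset_swap) auto
        moreover have "take (Suc j) ?w = (take (Suc j) w)[i := take (Suc j) w ! Suc i, Suc i := take (Suc j) w ! i]"
          using \<open>i < j\<close> by (simp add: take_update_swap)
        ultimately show ?thesis by (metis mset_eq_setD)
      qed
      then have "i \<in> ?D ?w" using nd[of i w ?w, OF x(4)] by auto
      moreover have "?w \<noteq> w" using i len dw
        by (metis Suc_less_eq length_list_update less_SucI n_not_Suc_n nth_eq_iff_index_eq nth_list_update_eq)
      moreover have "?w[i := ?w ! Suc i, Suc i := ?w ! i] = w"
        using i len by (intro nth_equalityI) (auto simp: nth_list_update)
      ultimately show ?thesis using x False f s len by (simp add: g_def Q_def R_def U_def)
    qed
  qed
  have ev: "even (card (Q - R))"
    using g finQ by (intro even_card_involution[where f = g]) auto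
  \<comment> \<open>Appending \<open>(Suc n, True)\<close> identifies the alternating flags of
    dimension \<open>n\<close> with \<open>R\<close>, whose parity then follows from the induction
    hypothesis.\<close>
  have R: "R = (\<lambda>w. (w @ [(Suc n, True)], n)) ` {w \<in> flags n. \<forall>i<n. prefix_sign \<sigma> w i = even i}" (is "_ = ?f ` ?G")
  proof (intro equalityI subsetI)
    fix x assume "x \<in> R"
    then obtain w where x: "x = (w, n)" "w \<in> flags (Suc n)" "last w = (Suc n, True)" "n \<in> ?D w"
      by (auto simp: R_def Q_def U_def)
    have len: "length w = Suc n" using x(2) by (rule length_flags)
    obtain v where v: "w = v @ [(Suc n, True)]"
      using x(3) len by (metis append_butlast_last_id length_0_conv nat.distinct(1))
    have "fst ` set v = {1..Suc n} - {Suc n}" using x(2) unfolding v flags_def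
      by (auto simp: image_iff)
    also have "\<dots> = {1..n}" by auto
    finally have "v \<in> flags n" using x(2) unfolding v flags_def by auto
    moreover have "\<forall>i<n. prefix_sign \<sigma> v i = even i"
      using x(4) length_flags[OF \<open>v \<in> flags n\<close>] unfolding v switch_points_def p_def by simp
    ultimately show "x \<in> ?f ` ?G" using x v by auto
  next
    fix x assume "x \<in> ?f ` ?G"
    then obtain v where v: "x = (v @ [(Suc n, True)], n)" "v \<in> flags n" "\<forall>i<n. prefix_sign \<sigma> v i = even i"
      by auto
    have "insert (Suc n) {1..n} = {1..Suc n}" by auto
    then have "v @ [(Suc n, True)] \<in> flags (Suc n)" using v(2) by (auto simp: flags_def)
    moreover have "n \<in> ?D (v @ [(Suc n, True)])"
      using v(3) length_flags[OF v(2)] unfolding switch_points_def p_def by auto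
    ultimately show "x \<in> R" unfolding v(1) R_def Q_def U_def by simp
  qed
  have "odd (card ?G)"
  proof (rule Suc.IH)
    fix X :: "(nat \<times> bool) set"
    assume X: "X \<noteq> {}" "inj_on fst X" "fst ` X \<subseteq> {1..n}"
    have "{1..n} \<subseteq> {1..Suc n}" by auto
    with X(3) have "fst ` X \<subseteq> {1..Suc n}" by (rule order_trans)
    with X show "\<sigma> (flip ` X) = (\<not> \<sigma> X)" by (intro Suc.prems)
  qed
  moreover have "inj_on ?f ?G" by (auto intro: inj_onI)
  ultimately have "odd (card R)" using R by (simp add: card_image)
  moreover have "R \<subseteq> Q" by (auto simp: R_def)
  ultimately have "odd (card Q)"
    using ev card_Int_Diff[OF finQ, of R] by (simp add: Int_absorb1)
  also have "card Q = (\<Sum>w\<in>U. card (?D w))" unfolding Q_def using finU finD by simp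
  finally have oU: "odd (\<Sum>w\<in>U. card (?D w))" .
  let ?P = "\<lambda>w. \<forall>j<Suc n. p w j"
  let ?N = "\<lambda>w. \<forall>j<Suc n. \<not> p w j"
  \<comment> \<open>Only flags with alternating signs have an odd number of switch points:
    \<open>?P\<close> if the first sign is true, \<open>?N\<close> if it is false.\<close>
  have "{w \<in> U. odd (card (?D w))} = {w \<in> U. ?P w} \<union> {w \<in> U. ?N w}"
    by (auto simp: odd_card_switch_points)
  with oU finU have o: "odd (card ({w \<in> U. ?P w} \<union> {w \<in> U. ?N w}))"
    by (simp add: even_sum_iff)
  have fl: "p (map flip w) j \<longleftrightarrow> \<not> p w j" if "w \<in> flags (Suc n)" "j < Suc n" for w j
  proof -
    have "set (take (Suc j) (map flip w)) = flip ` set (take (Suc j) w)" by (simp add: take_map)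
    moreover have "set (take (Suc j) w) \<noteq> {}" using length_flags[OF that(1)] by auto
    ultimately show ?thesis unfolding p_def using Suc.prems[OF _ flags_take[OF that(1)], of "Suc j"] by auto
  qed
  have mf: "map flip w \<in> flags (Suc n)" if "w \<in> flags (Suc n)" for w
    using that by (auto simp: flags_def image_image)
  have sg: "(Suc n, True) \<in> set w \<longleftrightarrow> (Suc n, False) \<notin> set w" if "w \<in> flags (Suc n)" for w
  proof -
    have "Suc n \<in> fst ` set w" using that by (simp add: flags_def)
    then obtain b where "(Suc n, b) \<in> set w" by auto
    moreover have "inj_on fst (set w)" using that by (simp add: flags_def distinct_map)
    ultimately show ?thesis using inj_onD[of fst "set w" "(Suc n, True)" "(Suc n, False)"] by (cases b) auto
  qed
  have fT: "(Suc n, c) \<in> set (map flip w) \<longleftrightarrow> (Suc n, \<not> c) \<in> set w" for w c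
    by (simp add: flip_image_iff)
  \<comment> \<open>The antipodal map trades the alternating flags of \<open>U\<close> with first
    sign false for those outside \<open>U\<close> with first sign true. Both kinds in
    \<open>U\<close> together therefore number as many as all flags satisfying
    \<open>?P\<close>.\<close>
  have "bij_betw (map flip) {w \<in> U. ?N w} {w \<in> flags (Suc n) - U. ?P w}"
  proof (intro bij_betw_byWitness[where f' = "map flip"] subsetI)
    fix v assume "v \<in> map flip ` {w \<in> U. ?N w}"
    then obtain w where w: "v = map flip w" "w \<in> flags (Suc n)" "(Suc n, True) \<in> set w" "?N w"
      unfolding U_def by blast
    have "(Suc n, True) \<notin> set v" unfolding w(1) fT using sg[OF w(2)] w(3) by simp
    then show "v \<in> {w \<in> flags (Suc n) - U. ?P w}"
      using w mf[OF w(2)] fl[OF w(2)] by (simp add: U_def)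
  next
    fix v assume "v \<in> map flip ` {w \<in> flags (Suc n) - U. ?P w}"
    then obtain w where w: "v = map flip w" "w \<in> flags (Suc n)" "(Suc n, True) \<notin> set w" "?P w"
      unfolding U_def by blast
    have "(Suc n, True) \<in> set v" unfolding w(1) fT using sg[OF w(2)] w(3) by simp
    then show "v \<in> {w \<in> U. ?N w}"
      using w mf[OF w(2)] fl[OF w(2)] by (simp add: U_def)
  qed auto
  then have "card {w \<in> U. ?N w} = card {w \<in> flags (Suc n) - U. ?P w}" by (rule bij_betw_same_card)
  moreover have "card ({w \<in> U. ?P w} \<union> {w \<in> U. ?N w}) = card {w \<in> U. ?P w} + card {w \<in> U. ?N w}"
    using finU by (intro card_Un_disjoint) auto
  moreover have "{w \<in> flags (Suc n). ?P w} = {w \<in> U. ?P w} \<union> {w \<in> flags (Suc n) - U. ?P w}"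
    unfolding U_def by auto
  moreover have "card ({w \<in> U. ?P w} \<union> {w \<in> flags (Suc n) - U. ?P w}) = card {w \<in> U. ?P w} + card {w \<in> flags (Suc n) - U. ?P w}"
    using finU finite_flags by (intro card_Un_disjoint) auto
  ultimately have "odd (card {w \<in> flags (Suc n). ?P w})" using o by simp
  then show ?case unfolding p_def .
qed

section \<open>Alternating sequences and zigzags\<close>

text \<open>Let the sign of \<open>X\<close> be the \<open>b\<close> with the larger
  \<open>L X b\<close>. It is antipodal, so the number of flags with alternating signs is odd.
  Monotonicity passes the larger value of a prefix on to the same sign of the next prefix, where it
  is the smaller of the two values; this gives the strict increase.\<close>

lemma alternating_flag_exists:
  fixes L :: "(nat \<times> bool) set \<Rightarrow> bool \<Rightarrow> nat"
  assumes mono: "\<And>X Y b. X \<subseteq> Y \<Longrightarrow> finite Y \<Longrightarrow> L X b \<le> L Y b"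
    and flip: "\<And>X b. L (flip ` X) b = L X (\<not> b)"
    and neq: "\<And>X. X \<noteq> {} \<Longrightarrow> inj_on fst X \<Longrightarrow> fst ` X \<subseteq> {1..n} \<Longrightarrow> L X True \<noteq> L X False"
  obtains w where "w \<in> flags n"
    "\<And>i. i < n \<Longrightarrow> L (set (take (Suc i) w)) (odd i) < L (set (take (Suc i) w)) (even i)"
    "\<And>i. Suc i < n \<Longrightarrow> L (set (take (Suc i) w)) (even i) < L (set (take (Suc (Suc i)) w)) (even (Suc i))"
proof -
  define \<sigma> where "\<sigma> X \<longleftrightarrow> L X False < L X True" for X
  have "odd (card {w \<in> flags n. \<forall>i<n. prefix_sign \<sigma> w i = even i})"
  proof (rule odd_card_alternating_flags)
    fix X :: "(nat \<times> bool) set"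
    assume "X \<noteq> {}" "inj_on fst X" "fst ` X \<subseteq> {1..n}"
    then have "L X True \<noteq> L X False" by (rule neq)
    then show "\<sigma> (flip ` X) = (\<not> \<sigma> X)" by (auto simp: \<sigma>_def flip)
  qed
  then have "{w \<in> flags n. \<forall>i<n. prefix_sign \<sigma> w i = even i} \<noteq> {}" by (metis card.empty even_zero)
  then obtain w where w: "w \<in> flags n" "\<And>i. i < n \<Longrightarrow> prefix_sign \<sigma> w i = even i" by auto
  have 1: "L (set (take (Suc i) w)) (odd i) < L (set (take (Suc i) w)) (even i)" if "i < n" for i
  proof -
    have "set (take (Suc i) w) \<noteq> {}" using length_flags[OF w(1)] that by auto
    then have "L (set (take (Suc i) w)) True \<noteq> L (set (take (Suc i) w)) False"
      using flags_take[OF w(1)] by (rule neq)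
    then show ?thesis using w(2)[OF that] by (cases "even i") (auto simp: \<sigma>_def)
  qed
  have "L (set (take (Suc i) w)) (even i) < L (set (take (Suc (Suc i)) w)) (even (Suc i))"
    if "Suc i < n" for i
  proof -
    have "L (set (take (Suc i) w)) (even i) \<le> L (set (take (Suc (Suc i)) w)) (even i)"
      by (intro mono set_take_subset_set_take) auto
    also have "\<dots> < L (set (take (Suc (Suc i)) w)) (even (Suc i))"
      using 1[OF that] by simp
    finally show ?thesis .
  qed
  with w(1) 1 show thesis by (rule that)
qed

section \<open>Longest alternating subsequences of a signed set\<close>

definition alternates :: "(nat \<times> bool) set \<Rightarrow> bool \<Rightarrow> nat list \<Rightarrow> bool" where
  "alternates X b xs \<longleftrightarrow> sorted_wrt (<) xs \<and> (\<forall>i<length xs. (xs ! i, b = even i) \<in> X)"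

definition alt_len :: "(nat \<times> bool) set \<Rightarrow> bool \<Rightarrow> nat" where
  "alt_len X b = Max (length ` Collect (alternates X b))"

lemma alternates_Nil [simp]: "alternates X b []"
  by (simp add: alternates_def)

lemma alternates_Cons:
  assumes "alternates X b (y # ys)" "(x, \<not> b) \<in> X" "x < y"
  shows "alternates X (\<not> b) (x # y # ys)"
proof -
  have "sorted_wrt (<) (x # y # ys)"
    using assms by (auto simp: alternates_def)
  moreover have "((x # y # ys) ! i, (\<not> b) = even i) \<in> X" if "i < length (x # y # ys)" for i
  proof (cases i)
    case (Suc j)
    then have "((y # ys) ! j, b = even j) \<in> X" using assms(1) that unfolding alternates_def by auto
    then show ?thesis using Suc by (simp add: eq_commute) 
  qed (use assms in simp)
  ultimately show ?thesis unfolding alternates_def by blast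
qed

text \<open>An alternating list has distinct entries, all of them coordinates of \<open>X\<close>.
  This makes the \<open>Max\<close> in \<open>alt_len\<close> meaningful.\<close>

lemma finite_alternates_lengths:
  assumes "finite X"
  shows "finite (length ` Collect (alternates X b))"
proof -
  have "length xs \<le> card (fst ` X)" if "alternates X b xs" for xs
  proof -
    have "set xs \<subseteq> fst ` X"
      using that by (force simp: alternates_def in_set_conv_nth)
    moreover have "distinct xs"
      using that by (simp add: alternates_def strict_sorted_iff)
    ultimately show ?thesis
      using assms by (metis card_mono distinct_card finite_imageI)
  qed
  then have "length ` Collect (alternates X b) \<subseteq> {..card (fst ` X)}" by auto
  then show ?thesis by (rule finite_subset) simp
qed

lemma length_le_alt_len: "finite X \<Longrightarrow> alternates X b xs \<Longrightarrow> length xs \<le> alt_len X b"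
  unfolding alt_len_def by (intro Max_ge finite_alternates_lengths) auto

lemma alt_len_attained:
  assumes "finite X"
  obtains xs where "alternates X b xs" "length xs = alt_len X b"
proof -
  have "alternates X b []" by simp
  then have "length ` Collect (alternates X b) \<noteq> {}" by blast
  then have "alt_len X b \<in> length ` Collect (alternates X b)"
    unfolding alt_len_def by (intro Max_in finite_alternates_lengths assms)
  then show thesis using that by auto
qed

lemma alt_len_mono:
  assumes "X \<subseteq> Y" "finite Y"
  shows "alt_len X b \<le> alt_len Y b"
proof -
  obtain xs where xs: "alternates X b xs" "length xs = alt_len X b"
    using alt_len_attained finite_subset[OF assms] by metis
  then have "alternates Y b xs" using assms(1) by (auto simp: alternates_def)
  then show ?thesis using length_le_alt_len[OF assms(2)] xs(2) by metis
qed

lemma alt_len_flip: "alt_len (flip ` X) b = alt_len X (\<not> b)"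
proof -
  have "alternates (flip ` X) b xs = alternates X (\<not> b) xs" for xs
  proof -
    have "(xs ! i, b = even i) \<in> flip ` X \<longleftrightarrow> (xs ! i, (\<not> b) = even i) \<in> X" for i
      unfolding flip_image_iff flip_Pair by (cases b) simp_all
    then show ?thesis by (simp only: alternates_def)
  qed
  then have "alternates (flip ` X) b = alternates X (\<not> b)" by (intro ext)
  then show ?thesis by (simp only: alt_len_def)
qed

text \<open>Prepending the smaller of the two first entries lengthens the other sequence.\<close>

lemma alt_len_True_neq_False:
  assumes "finite X" "X \<noteq> {}" "inj_on fst X"
  shows "alt_len X True \<noteq> alt_len X False"
proof
  assume eq: "alt_len X True = alt_len X False"
  obtain a b where ab: "(a, b) \<in> X" using assms(2) by auto
  then have "alternates X b [a]" by (simp add: alternates_def)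
  then have "1 \<le> alt_len X b" using length_le_alt_len[OF assms(1)] by fastforce
  then have pos: "1 \<le> alt_len X c" for c using eq by (cases b; cases c) auto
  have ex: "\<exists>y ys. alternates X c (y # ys) \<and> length (y # ys) = alt_len X c" for c
  proof -
    obtain xs where "alternates X c xs" "length xs = alt_len X c"
      using alt_len_attained[OF assms(1)] by metis
    then show ?thesis using pos[of c] by (cases xs) auto
  qed
  have len: "alt_len X c = alt_len X d" for c d using eq by (cases c; cases d) auto
  have less: False if "alternates X (\<not> c) (y # ys)" "length (y # ys) = alt_len X (\<not> c)"
      "(x, c) \<in> X" "x < y" for c x y ys
  proof -
    have "alternates X c (x # y # ys)" using alternates_Cons[OF that(1) _ that(4)] that(3) by simp
    then have "length (x # y # ys) \<le> alt_len X c" by (rule length_le_alt_len[OF assms(1)])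
    then show False using that(2) len[of c "\<not> c"] by simp
  qed
  obtain x xs where x: "alternates X True (x # xs)" "length (x # xs) = alt_len X True" using ex by blast
  obtain y ys where y: "alternates X False (y # ys)" "length (y # ys) = alt_len X False" using ex by blast
  have mx: "(x, True) \<in> X" and my: "(y, False) \<in> X" 
    using x(1) y(1) by (force simp: alternates_def)+
  then have "x \<noteq> y" using inj_onD[OF assms(3) _ mx my] by auto
  then consider "x < y" | "y < x" by linarith
  then show False
    using less[of True y ys x] less[of False x xs y] x y mx my by cases auto
qed

text \<open>The number of distinct levels below the coloured sets is \<open>M - 1\<close>, so a flag with alternating signs
  passes through at least \<open>n - M + 1\<close> coloured sets with increasing largest colours. One more colour
  comes from the other sign of the first coloured set, since both signs are hit there.\<close>

lemma zigzag_of_alternating_hits: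
  fixes V :: "nat set set" and c :: "nat set \<Rightarrow> nat"
  assumes "finite V" "2 \<le> M" "M \<le> n"
    and proper: "\<And>S T. S \<in> V \<Longrightarrow> T \<in> V \<Longrightarrow> S \<inter> T = {} \<Longrightarrow> c S \<noteq> c T"
    and hit: "\<And>xs p. sorted_wrt (<) xs \<Longrightarrow> set xs \<subseteq> {1..n} \<Longrightarrow> length xs = M \<Longrightarrow>
      \<exists>S\<in>V. S \<subseteq> {xs ! i | i. i < M \<and> even i = p}"
  obtains T :: "nat \<Rightarrow> nat set" where
    "\<And>j. j < n - M + 2 \<Longrightarrow> T j \<in> V"
    "\<And>i j. i < n - M + 2 \<Longrightarrow> j < n - M + 2 \<Longrightarrow> even i \<noteq> even j \<Longrightarrow> T i \<inter> T j = {}"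
    "\<And>j. Suc j < n - M + 2 \<Longrightarrow> c (T j) < c (T (Suc j))"
proof -
  define C where "C X b = {S \<in> V. S \<times> {b} \<subseteq> X}" for X :: "(nat \<times> bool) set" and b
  \<comment> \<open>The inserted 0 is a default that keeps \<open>Max\<close> defined, and monotone
    in \<open>X\<close>, when \<open>C X b\<close> is empty.\<close>
  define m where "m X b = Max (insert 0 (c ` C X b))" for X b
  define big where "big X \<longleftrightarrow> M \<le> alt_len X True \<or> M \<le> alt_len X False" for X
  have disj: "S \<inter> T = {}" if ST: "S \<times> {a} \<subseteq> X" "T \<times> {b} \<subseteq> X" "inj_on fst X" "a \<noteq> b"
    for S T :: "nat set" and a b :: bool and X
  proof (rule ccontr)
    assume "S \<inter> T \<noteq> {}"
    then obtain i where "(i, a) \<in> X" "(i, b) \<in> X" using ST(1,2) by blast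
    then show False using inj_onD[OF ST(3), of "(i, a)" "(i, b)"] ST(4) by simp
  qed
  \<comment> \<open>A set that is not big has values at most \<open>M - 1\<close>, so this offset
    preserves monotonicity when a set becomes big.\<close>
  define L where "L X b = (if big X then M - 1 + m X b else alt_len X b)" for X b
  have finC: "finite (c ` C X b)" for X b using assms(1) by (simp add: C_def)
  have big_iff: "big X \<longleftrightarrow> (\<exists>b. M \<le> alt_len X b)" for X by (simp add: big_def ex_bool_eq)
  have ne: "C X b \<noteq> {}" if X: "big X" "finite X" "fst ` X \<subseteq> {1..n}" for X b
  proof -
    obtain b' where "M \<le> alt_len X b'" using X(1) big_iff by blast
    moreover obtain ys where "alternates X b' ys" "length ys = alt_len X b'"
      using alt_len_attained[OF X(2)] .
    ultimately have ys: "alternates X b' ys" "M \<le> length ys" by simp_all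
    define xs where "xs = take M ys"
    have xs: "sorted_wrt (<) xs" "length xs = M" "\<And>i. i < M \<Longrightarrow> (xs ! i, b' = even i) \<in> X"
      using ys by (auto simp: alternates_def xs_def sorted_wrt_take)
    have "set xs \<subseteq> fst ` X" using xs(2,3) by (force simp: in_set_conv_nth)
    \<comment> \<open>The entries of sign \<open>b\<close> sit at the even positions if
      \<open>b = b'\<close> and at the odd ones otherwise. Since \<open>hit\<close> covers both
      parities, both signs are served.\<close>
    then obtain S where S: "S \<in> V" "S \<subseteq> {xs ! i | i. i < M \<and> even i = (b = b')}"
      using hit[OF xs(1) _ xs(2)] X(3) by blast
    have "S \<times> {b} \<subseteq> X"
    proof clarify
      fix a assume "a \<in> S"
      then obtain i where "a = xs ! i" "i < M" "even i = (b = b')" using S(2) by auto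
      moreover from this have "(b' = even i) = b" by auto
      ultimately show "(a, b) \<in> X" using xs(3)[of i] by simp
    qed
    then show ?thesis using S(1) by (auto simp: C_def)
  qed
  have m: "\<exists>S\<in>V. S \<times> {b} \<subseteq> X \<and> m X b = c S" if "big X" "finite X" "fst ` X \<subseteq> {1..n}" for X b
  proof -
    have "m X b = Max (c ` C X b)"
      using ne[OF that] finC by (simp add: m_def)
    then have "m X b \<in> c ` C X b" using ne[OF that] finC by (metis Max_in image_is_empty)
    then show ?thesis by (auto simp: C_def)
  qed
  obtain w where w: "w \<in> flags n"
    "\<And>i. i < n \<Longrightarrow> L (set (take (Suc i) w)) (odd i) < L (set (take (Suc i) w)) (even i)"
    "\<And>i. Suc i < n \<Longrightarrow> L (set (take (Suc i) w)) (even i) < L (set (take (Suc (Suc i)) w)) (even (Suc i))"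
  proof (rule alternating_flag_exists[of L n])
    fix X Y :: "(nat \<times> bool) set" and b assume XY: "X \<subseteq> Y" "finite Y"
    have b: "big Y" if "big X" using that alt_len_mono[OF XY] by (meson big_def le_trans)
    have "C X b \<subseteq> C Y b" using XY(1) by (auto simp: C_def)
    then have mm: "m X b \<le> m Y b" unfolding m_def using finC by (intro Max_mono) auto
    have "alt_len X b \<le> M - 1" if "\<not> big X"
    proof -
      have "\<not> M \<le> alt_len X b" using that big_iff by blast
      then show ?thesis by simp
    qed
    then show "L X b \<le> L Y b" using b mm alt_len_mono[OF XY, of b] by (auto simp: L_def)
  next
    fix X :: "(nat \<times> bool) set" and b
    have "S \<times> {b} \<subseteq> flip ` X \<longleftrightarrow> S \<times> {\<not> b} \<subseteq> X" for S by (auto simp: flip_image_iff)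
    then have "C (flip ` X) b = C X (\<not> b)" by (simp add: C_def)
    then show "L (flip ` X) b = L X (\<not> b)"
      by (auto simp: L_def m_def big_def alt_len_flip)
  next
    fix X :: "(nat \<times> bool) set"
    assume X: "X \<noteq> {}" "inj_on fst X" "fst ` X \<subseteq> {1..n}"
    have fin: "finite X" using finite_imageD[OF finite_subset[OF X(3)] X(2)] by simp
    show "L X True \<noteq> L X False"
    proof (cases "big X")
      case True
      obtain S where S: "S \<in> V" "S \<times> {True} \<subseteq> X" "m X True = c S" using m[OF True fin X(3)] by blast
      obtain T where T: "T \<in> V" "T \<times> {False} \<subseteq> X" "m X False = c T" using m[OF True fin X(3)] by blast
      \<comment> \<open>No coordinate of \<open>X\<close> carries both signs, so the two sets of
        largest colour are disjoint and properness separates their colours.\<close>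
      have "S \<inter> T = {}" by (rule disj[OF S(2) T(2) X(2)]) simp
      then show ?thesis using proper[OF S(1) T(1)] S(3) T(3) True by (simp add: L_def)
    qed (use alt_len_True_neq_False[OF fin X(1,2)] in \<open>simp add: L_def\<close>)
  qed blast
  define P where "P i = set (take (Suc i) w)" for i
  have PL: "i < L (P i) (even i)" if "i < n" for i
    using that
  proof (induction i)
    case 0
    then show ?case using w(2)[of 0] by (simp add: P_def)
  next
    case (Suc i)
    then have "Suc i \<le> L (P i) (even i)" by simp
    also have "\<dots> < L (P (Suc i)) (even (Suc i))" unfolding P_def using w(3)[OF Suc.prems] .
    finally show ?case .
  qed
  \<comment> \<open>The larger value at position \<open>i\<close> exceeds \<open>i\<close>, hence
    \<open>M - 1\<close>, which only a big set can reach.\<close>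
  have big: "big (P i)" if "i < n" "M - 1 \<le> i" for i
  proof (rule ccontr)
    assume n: "\<not> big (P i)"
    then have "M \<le> alt_len (P i) (even i)" using PL[OF that(1)] that(2) by (simp add: L_def)
    then show False using n unfolding big_iff by blast
  qed
  \<comment> \<open>Positions \<open>M - 1, M - 1, M, ...\<close>: the first prefix known to be big
    serves both \<open>j = 0\<close> and \<open>j = 1\<close>. For \<open>j >= 1\<close> the sign
    \<open>even (M + j)\<close> is the one of larger value at \<open>pos j\<close>; for
    \<open>j = 0\<close> it is the other sign.\<close>
  define pos where "pos j = max (M - 1) (M - 2 + j)" for j
  have pos: "M - 1 \<le> pos j" "j < n - M + 2 \<Longrightarrow> pos j < n" for j
    using assms(2,3) by (auto simp: pos_def)
  have "\<exists>S\<in>V. S \<times> {even (M + j)} \<subseteq> P (pos j) \<and> m (P (pos j)) (even (M + j)) = c S"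
    if "j < n - M + 2" for j
    using m[OF big[OF pos(2)[OF that] pos(1)]] flags_take[OF w(1)] unfolding P_def by blast
  then obtain T where T: "\<And>j. j < n - M + 2 \<Longrightarrow> T j \<in> V"
     "\<And>j. j < n - M + 2 \<Longrightarrow> T j \<times> {even (M + j)} \<subseteq> P (pos j)"
     "\<And>j. j < n - M + 2 \<Longrightarrow> m (P (pos j)) (even (M + j)) = c (T j)"
    by metis
  show thesis
  proof (rule that)
    show "T j \<in> V" if "j < n - M + 2" for j using T(1) that .
  next
    fix i j assume ij: "i < n - M + 2" "j < n - M + 2" "even i \<noteq> even j"
    have "P l \<subseteq> set w" for l unfolding P_def by (rule set_take_subset)
    then have *: "T i \<times> {even (M + i)} \<subseteq> set w" "T j \<times> {even (M + j)} \<subseteq> set w"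
      using T(2) ij(1,2) by blast+
    have "inj_on fst (set w)" using w(1) by (simp add: flags_def distinct_map)
    then show "T i \<inter> T j = {}" by (rule disj[OF *]) (use ij(3) in simp)
  next
    fix j assume j: "Suc j < n - M + 2"
    have LP: "L (P (pos i)) b = M - 1 + m (P (pos i)) b" if "i < n - M + 2" for i b
      using big[OF pos(2)[OF that] pos(1)] by (simp add: L_def)
    have "L (P (pos j)) (even (M + j)) < L (P (pos (Suc j))) (even (M + Suc j))"
    proof (cases j)
      case 0
      obtain M' where M': "M = Suc (Suc M')" using assms(2) le_Suc_ex[of 2 M] by auto
      have "pos j = M - 1" "pos (Suc j) = M - 1" using 0 M' by (auto simp: pos_def)
      moreover have "even (M + j) = odd (M - 1)" "even (M + Suc j) = even (M - 1)" using 0 M' by auto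
      ultimately show ?thesis unfolding P_def using w(2)[of "M - 1"] assms(2,3) by simp
    next
      case (Suc i)
      have p: "pos j = M - 2 + j" "pos (Suc j) = Suc (M - 2 + j)" using Suc assms(2) by (auto simp: pos_def)
      have e1: "even (M + j) = even (M - 2 + j)" using assms(2) by auto
      then have e2: "even (M + Suc j) = even (Suc (M - 2 + j))" by auto
      have e3: "Suc (M - 2 + j) < n" using j assms(2,3) by auto
      show ?thesis unfolding p P_def e1 e2 by (rule w(3)[OF e3])
    qed
    then show "c (T j) < c (T (Suc j))"
      using LP[of j] LP[of "Suc j"] T(3)[of j] T(3)[of "Suc j"] j by simp
  qed
qed

section \<open>Stable subsets of points on a circle\<close>

text \<open>\<open>p\<close> enumerates, lifted to the line, \<open>K\<close> points on a circle of length \<open>n\<close>.\<close>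

locale circular_points =
  fixes p :: "nat \<Rightarrow> nat" and K n h :: nat
  assumes K: "0 < K" and h: "0 < h"
    and per: "\<And>i. p (i + K) = p i + n"
    and gap: "\<And>i. p i + 2 \<le> p (Suc i)"
begin

section \<open>The greedy walk on the lifted points\<close>

lemma mult_per: "p (i + r * K) = p i + r * n"
proof (induction r)
  case (Suc r)
  have "p (i + Suc r * K) = p ((i + r * K) + K)" by (simp add: algebra_simps)
  then show ?case using Suc per by simp
qed simp

lemma gap_add: "p i + 2 * j \<le> p (i + j)"
proof (induction j)
  case (Suc j)
  then show ?case using gap[of "i + j"] by simp
qed simp

lemma strict: "strict_mono p"
  by (rule strict_mono_Suc_iff[THEN iffD2]) (use gap in \<open>auto intro: less_le_trans[OF _ gap]\<close>)

text \<open>The greedy step towards a set with distances at least \<open>2 * h\<close>. The minimum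
  exists because \<open>h\<close> consecutive gaps of at least 2 cover that distance.\<close>

definition hop :: "nat \<Rightarrow> nat" where
  "hop i = (LEAST j. p i + 2 * h \<le> p j)"

lemma hop_ge: "p i + 2 * h \<le> p (hop i)"
  unfolding hop_def by (rule LeastI[of _ "i + h"]) (rule gap_add)

lemma hop_le: "hop i \<le> i + h"
  unfolding hop_def by (rule Least_le) (rule gap_add)

lemma hop_gt: "i < hop i"
proof -
  have "p i < p (hop i)" using hop_ge[of i] h by linarith
  then show ?thesis using strict by (simp add: strict_mono_less)
qed

lemma pred_hop: "p (hop i - 1) < p i + 2 * h"
proof -
  have "hop i - 1 < hop i" using hop_gt[of i] by simp
  then have "\<not> p i + 2 * h \<le> p (hop i - 1)" unfolding hop_def by (rule not_less_Least)
  then show ?thesis by simp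
qed

lemma hop_per: "hop (i + K) = hop i + K"
proof (rule antisym)
  show "hop (i + K) \<le> hop i + K"
    unfolding hop_def[of "i + K"] by (rule Least_le) (use hop_ge[of i] per in simp)
next
  have "i + K < hop (i + K)" by (rule hop_gt)
  then obtain j where j: "hop (i + K) = j + K" by (metis add.commute le_add_diff_inverse less_imp_le trans_le_add2 le_add2 add_leD2)
  then have "p i + 2 * h \<le> p j" using hop_ge[of "i + K"] per by simp
  then have "hop i \<le> j" unfolding hop_def by (rule Least_le)
  then show "hop i + K \<le> hop (i + K)" using j by simp
qed

lemma hop_pow_per: "(hop ^^ m) (i + r * K) = (hop ^^ m) i + r * K"
proof (induction m)
  case (Suc m)
  have *: "hop (a + r * K) = hop a + r * K" for a
  proof (induction r)
    case (Suc r)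
    have "hop (a + Suc r * K) = hop (a + r * K + K)" by (simp add: algebra_simps)
    then show ?case using Suc hop_per by simp
  qed simp
  show ?case using Suc * by simp
qed simp

lemma hop_pow_le: "(hop ^^ m) i \<le> i + m * h"
proof (induction m)
  case (Suc m)
  then show ?case using hop_le[of "(hop ^^ m) i"] by simp
qed simp

lemma hop_pow_ge: "i + m \<le> (hop ^^ m) i"
proof (induction m)
  case (Suc m)
  then show ?case using hop_gt[of "(hop ^^ m) i"] by simp
qed simp

text \<open>Pigeonhole modulo \<open>K\<close> along the walk from 0. At the first repetition all
  earlier residues are distinct; starting from the earlier visit of the repeated residue gives the
  periodic orbit.\<close>

lemma hop_cycle:
  obtains i m r where "0 < m" "(hop ^^ m) i = i + r * K" "inj_on (\<lambda>j. (hop ^^ j) i mod K) {..<m}"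
proof -
  let ?z = "\<lambda>j. (hop ^^ j) 0 mod K"
  define P where "P j \<longleftrightarrow> (\<exists>l<j. ?z l = ?z j)" for j
  have "\<exists>j. P j"
  proof (rule ccontr)
    assume "\<not> (\<exists>j. P j)"
    then have "inj ?z" by (intro linorder_injI) (auto simp: P_def)
    moreover have "range ?z \<subseteq> {..<K}" using K by auto
    ultimately show False by (metis finite_imageD finite_lessThan finite_subset infinite_UNIV_nat)
  qed
  then have P: "P (LEAST j. P j)" by (rule LeastI_ex)
  define j where "j = (LEAST j. P j)"
  have min: "\<not> P l" if "l < j" for l using that not_less_Least unfolding j_def by blast
  obtain l where l: "l < j" "?z l = ?z j" using P[folded j_def] unfolding P_def by blast
  have inj: "inj_on ?z {..<j}"
  proof (rule linorder_inj_onI')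
    fix a b assume "a \<in> {..<j}" "b \<in> {..<j}" "a < b"
    then show "?z a \<noteq> ?z b" using min[of b] by (auto simp: P_def)
  qed
  define i where "i = (hop ^^ l) 0"
  have it: "(hop ^^ a) i = (hop ^^ (a + l)) 0" for a by (simp add: i_def funpow_add)
  have ij: "(hop ^^ (j - l)) i = (hop ^^ j) 0" using l(1) by (simp add: it)
  have "i \<le> (hop ^^ (j - l)) i" using hop_pow_ge[of i "j - l"] by simp
  moreover have "i mod K = (hop ^^ (j - l)) i mod K" unfolding ij using l(2) by (simp add: i_def)
  ultimately obtain r where "(hop ^^ (j - l)) i = i + K * r" by (metis mod_eq_nat1E)
  moreover have "inj_on (\<lambda>a. (hop ^^ a) i mod K) {..<j - l}"
  proof (rule inj_onI)
    fix a b assume "a \<in> {..<j - l}" "b \<in> {..<j - l}" "(hop ^^ a) i mod K = (hop ^^ b) i mod K"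
    then show "a = b" using inj_onD[OF inj, of "a + l" "b + l"] by (auto simp: it)
  qed
  ultimately show thesis using that[of "j - l" i r] l(1) by (simp add: mult.commute)
qed

text \<open>If every greedy walk of \<open>k\<close> steps overshot the full circle, a periodic orbit of \<open>m\<close> steps
  winding \<open>r\<close> times would have \<open>m < r k\<close>. Each step, without the gap it ends with, is shorter than
  \<open>2 h\<close>, and these final gaps are distinct, so that they sum up to at most \<open>n - 2 (K - m)\<close>. Hence
  \<open>r n \<le> m (2 h - 1) + n - 2 (K - m)\<close>, which makes the circle too short.\<close>

lemma greedy_walk_fits:
  assumes k: "2 \<le> k" and K': "K = h * (k - 1) + 1" and n: "(2 * h + 2) * k - 2 \<le> n"
  shows "\<exists>i. (hop ^^ k) i \<le> i + K"
proof (rule ccontr)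
  assume "\<not> ?thesis"
  then have over: "i + Suc K \<le> (hop ^^ k) i" for i by (simp add: not_le Suc_le_eq)
  obtain i m r where m: "0 < m" "(hop ^^ m) i = i + r * K"
    and inj: "inj_on (\<lambda>j. (hop ^^ j) i mod K) {..<m}" by (rule hop_cycle)
  have over_q: "i + q * Suc K \<le> (hop ^^ (q * k)) i" for q
  proof (induction q)
    case (Suc q)
    have "i + Suc q * Suc K \<le> (hop ^^ (q * k)) i + Suc K" using Suc by simp
    also have "\<dots> \<le> (hop ^^ k) ((hop ^^ (q * k)) i)" by (rule over)
    also have "\<dots> = (hop ^^ (Suc q * k)) i" by (simp add: funpow_add)
    finally show ?case .
  qed simp
  have wind_q: "(hop ^^ (q * m)) i = i + q * r * K" for q
  proof (induction q)
    case (Suc q)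
    have "(hop ^^ (Suc q * m)) i = (hop ^^ m) ((hop ^^ (q * m)) i)" by (simp add: funpow_add)
    also have "\<dots> = (hop ^^ m) i + q * r * K" by (simp only: Suc hop_pow_per)
    finally show ?case using m(2) by (simp add: algebra_simps)
  qed simp
  \<comment> \<open>Both bounds describe the walk after \<open>m * k\<close> hops: \<open>m\<close>
    overshooting walks of \<open>k\<close> hops, or \<open>k\<close> full periods.\<close>
  have "m * Suc K \<le> k * r * K"
    using over_q[of m] wind_q[of k] by (simp add: mult.commute)
  moreover have "m * K < m * Suc K" using m(1) by simp
  ultimately have "m * K < k * r * K" by linarith
  then have mr: "m < k * r" using K by simp
  have "i + r * K \<le> i + m * h" using hop_pow_le[of m i] m(2) by simp
  then have rK: "r * K \<le> m * h" by simp
  \<comment> \<open>For one winding, \<open>m <= k - 1\<close> hops of at most \<open>h\<close>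
    indices each advance by at most \<open>h * (k - 1) = K - 1\<close>, too little for a
    lap.\<close>
  have r2: "2 \<le> r"
  proof (rule ccontr)
    assume "\<not> 2 \<le> r"
    then consider "r = 0" | "r = 1" by linarith
    then show False
    proof cases
      case 2
      have "m \<le> k - 1" using mr 2 by simp
      then have "m * h \<le> h * (k - 1)" by (simp add: mult.commute)
      moreover have "K \<le> m * h" using rK 2 by simp
      ultimately show False using K' by linarith
    qed (use mr in simp)
  qed
  let ?z = "\<lambda>j. (hop ^^ j) i"
  define g where "g j = p (Suc j) - p j" for j
  have g2: "2 \<le> g j" for j using gap[of j] by (simp add: g_def)
  have gmod: "g (j mod K) = g j" for j
  proof -
    have "p j = p (j mod K) + (j div K) * n" "p (Suc j) = p (Suc (j mod K)) + (j div K) * n"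
      using mult_per[of "j mod K" "j div K"] mult_per[of "Suc (j mod K)" "j div K"]
      by (simp_all add: mod_mult_div_eq)
    then show ?thesis by (simp add: g_def)
  qed
  have sum_g: "(\<Sum>j<K. g j) = n"
  proof -
    have "(\<Sum>j<q. g j) = p q - p 0" for q
    proof (induction q)
      case (Suc q)
      have "p 0 \<le> p q" using strict by (simp add: strict_mono_less_eq)
      then show ?case using Suc gap[of q] by (simp add: g_def)
    qed simp
    then show ?thesis using per[of 0] by simp
  qed
  \<comment> \<open>The index modulo \<open>K\<close> of the gap that hop \<open>j\<close> ends
    with.\<close>
  let ?y = "\<lambda>j. (?z (Suc j) - 1) mod K"
  have zpos: "0 < ?z (Suc j)" for j using hop_gt[of "?z j"] by simp
  \<comment> \<open>The landing points of the \<open>m\<close> hops are, modulo \<open>K\<close>,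
    the orbit shifted cyclically by one, so they are distinct.\<close>
  have "inj_on ?y {..<m}"
  proof (rule inj_onI)
    fix a b assume ab: "a \<in> {..<m}" "b \<in> {..<m}" "?y a = ?y b"
    have "Suc (?z (Suc a) - 1) mod K = Suc (?z (Suc b) - 1) mod K"
      using ab(3) by (metis mod_Suc_eq)
    then have eq: "?z (Suc a) mod K = ?z (Suc b) mod K" using zpos by simp
    have red: "?z (Suc c) mod K = ?z (Suc c mod m) mod K" if "c < m" for c
    proof (cases "Suc c = m")
      case True
      then show ?thesis using m(2) by simp
    qed (use that in simp)
    have "?z (Suc a mod m) mod K = ?z (Suc b mod m) mod K"
      using eq red[of a] red[of b] ab(1,2) unfolding lessThan_iff by (simp only:)
    then have "Suc a mod m = Suc b mod m" by (rule inj_onD[OF inj]) (use m(1) in simp_all)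
    then show "a = b" using ab(1,2) by (auto simp: mod_Suc split: if_splits)
  qed
  then have "(\<Sum>j<m. g (?y j)) = sum g (?y ` {..<m})" and card_y: "card (?y ` {..<m}) = m"
    by (simp_all add: sum.reindex card_image)
  moreover have sub: "?y ` {..<m} \<subseteq> {..<K}" using K by auto
  moreover have "sum g {..<K} = sum g (?y ` {..<m}) + sum g ({..<K} - ?y ` {..<m})"
    using sub by (simp add: sum.subset_diff add.commute)
  moreover have "2 * card ({..<K} - ?y ` {..<m}) \<le> sum g ({..<K} - ?y ` {..<m})"
    using sum_mono[of "{..<K} - ?y ` {..<m}" "\<lambda>_. 2" g] g2 by simp
  moreover have "card ({..<K} - ?y ` {..<m}) = K - m" and mK: "m \<le> K"
    using sub card_y card_mono[OF _ sub] by (simp_all add: card_Diff_subset)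
  ultimately have gy: "(\<Sum>j<m. g (?y j)) + 2 * (K - m) \<le> n" using sum_g by linarith
  \<comment> \<open>The point before the landing point is strictly closer than \<open>2 * h\<close>;
    this saves 1 per hop and thus \<open>m\<close> in total.\<close>
  have step: "p (?z (Suc j)) + 1 \<le> p (?z j) + 2 * h + g (?y j)" for j
  proof -
    have "p (?z (Suc j) - 1) < p (?z j) + 2 * h" using pred_hop[of "?z j"] by simp
    moreover have "p (?z (Suc j)) = p (?z (Suc j) - 1) + g (?z (Suc j) - 1)"
      using zpos[of j] gap[of "?z (Suc j) - 1"] by (simp add: g_def)
    ultimately show ?thesis using gmod[of "?z (Suc j) - 1"] by simp
  qed
  have "p (?z q) + q \<le> p i + q * (2 * h) + (\<Sum>j<q. g (?y j))" for q
  proof (induction q)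
    case (Suc q)
    then show ?case using step[of q] by simp
  qed simp
  from this[of m] have "r * n + m \<le> m * (2 * h) + (\<Sum>j<m. g (?y j))"
    using m(2) mult_per[of i r] by simp
  then have "r * n + m + 2 * (K - m) \<le> m * (2 * h) + n" using gy by linarith
  then have "int r * int n + int m + 2 * (int K - int m) \<le> int m * (2 * int h) + int n"
  proof -
    assume "r * n + m + 2 * (K - m) \<le> m * (2 * h) + n"
    then have "int (r * n + m + 2 * (K - m)) \<le> int (m * (2 * h) + n)" by (rule of_nat_mono)
    then show ?thesis using mK by (simp add: of_nat_diff)
  qed
  then have 1: "(int r - 1) * int n \<le> int m * (2 * int h + 1) - 2 * int K" by (simp add: algebra_simps)
  have "int m < int (k * r)" using mr by (rule of_nat_less_iff[THEN iffD2])
  then have "int m \<le> int r * int k - 1" by (simp add: mult.commute)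
  then have "int m * (2 * int h + 1) \<le> (int r * int k - 1) * (2 * int h + 1)" by (intro mult_right_mono) auto
  with 1 have 2: "(int r - 1) * int n \<le> (int r * int k - 1) * (2 * int h + 1) - 2 * int K" by linarith
  have Ki: "int K = int h * (int k - 1) + 1" using K' k by (simp add: of_nat_diff)
  have "(2 * int h + 2) * int k - 2 \<le> int n"
  proof -
    have "(2 * h + 2) * k \<le> n + 2" using n by linarith
    then have "int ((2 * h + 2) * k) \<le> int (n + 2)" by (rule of_nat_mono)
    then show ?thesis by (simp add: algebra_simps)
  qed
  then have "(int r - 1) * ((2 * int h + 2) * int k - 2) \<le> (int r - 1) * int n"
    using r2 by (intro mult_left_mono) auto
  then have "(int r - 1) * ((2 * int h + 2) * int k - 2)
      \<le> (int r * int k - 1) * (2 * int h + 1) - 2 * (int h * (int k - 1) + 1)" using 2 unfolding Ki by (rule order_trans)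
  \<comment> \<open>After expansion all terms with \<open>h\<close> cancel. Since
    \<open>r >= 2\<close>, the left side is at least \<open>k - 2\<close>.\<close>
  then have "(int r - 1) * (int k - 2) \<le> int k - 3" by (simp add: algebra_simps)
  moreover have "1 * (int k - 2) \<le> (int r - 1) * (int k - 2)"
    using r2 k by (intro mult_right_mono) auto
  ultimately show False by simp
qed

end

section \<open>Stable sets inside alternating sequences\<close>

text \<open>Repeating the sorted elements of \<open>A\<close> with period \<open>n\<close> gives
  circular points with gaps at least 2. A greedy walk whose \<open>k\<close> hops stay within one
  lap visits \<open>k\<close> points whose positions on the circle form the required set.\<close>

lemma stable_subset_of_2_stable:
  assumes "0 < h" "0 < k" and n: "(2 * h + 2) * k - 2 \<le> n"
    and A: "A \<subseteq> {1..n}" "card A = h * (k - 1) + 1"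
    and stable: "\<And>i j. i \<in> A \<Longrightarrow> j \<in> A \<Longrightarrow> i < j \<Longrightarrow> i + 2 \<le> j \<and> j + 2 \<le> i + n"
  shows "\<exists>S\<subseteq>A. s_stable (2 * h) n S \<and> card S = k"
proof (cases "k = 1")
  case True
  obtain a where "a \<in> A" using A(2) by fastforce
  then have "{a} \<subseteq> A" "s_stable (2 * h) n {a}" "card {a} = k"
    using A(1) True by (auto simp: s_stable_def)
  then show ?thesis by blast
next
  case False
  then have k: "2 \<le> k" using assms(2) by simp
  define K where "K = h * (k - 1) + 1"
  have "1 \<le> h * (k - 1)" using k assms(1) by (simp add: Suc_le_eq)
  then have K2: "2 \<le> K" by (simp add: K_def)
  have finA: "finite A" using A(1) finite_subset by blast
  define a where "a = sorted_list_of_set A"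
  have len: "length a = K" using A(2) by (simp add: a_def K_def)
  have aA: "a ! i \<in> A" if "i < K" for i
    using nth_mem[of i a] that len finA by (simp add: a_def)
  have a_less: "a ! i < a ! j" if "i < j" "j < K" for i j
    using strict_sorted_list_of_set[of A] that len by (simp add: a_def sorted_wrt_nth_less)
  define p where "p i = n * (i div K) + a ! (i mod K)" for i
  interpret circular_points p K n h
  proof
    show "0 < K" "0 < h" using K2 assms(1) by simp_all
    show "p (i + K) = p i + n" for i using K2 by (simp add: p_def)
    show "p i + 2 \<le> p (Suc i)" for i
    proof (cases "Suc (i mod K) = K")
      case True
      have "a ! 0 < a ! (K - 1)" using a_less K2 by simp
      then have "a ! (K - 1) + 2 \<le> a ! 0 + n" using stable aA K2 by simp
      moreover have "i mod K = K - 1" using True by simp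
      ultimately show ?thesis using True by (simp add: p_def mod_Suc div_Suc)
    next
      case False
      have "i mod K < K" using K2 by simp
      then have j: "Suc (i mod K) < K" using False by simp
      then have "a ! (i mod K) + 2 \<le> a ! Suc (i mod K)" using stable aA a_less[of "i mod K" "Suc (i mod K)"] by simp
      then show ?thesis using False by (simp add: p_def mod_Suc div_Suc)
    qed
  qed
  obtain i where i: "(hop ^^ k) i \<le> i + K"
    using greedy_walk_fits[OF k K_def n] by blast
  define z where "z j = (hop ^^ j) i" for j
  define v where "v j = a ! (z j mod K)" for j
  have z_step: "p (z j) + 2 * h \<le> p (z (Suc j))" for j
    using hop_ge[of "z j"] by (simp add: z_def)
  have pz_mono: "p (z j) \<le> p (z l)" if "j \<le> l" for j l
  proof (rule lift_Suc_mono_le[of "\<lambda>j. p (z j)", OF _ that])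
    show "p (z j) \<le> p (z (Suc j))" for j using z_step[of j] by linarith
  qed
  have vA: "v j \<in> A" for j using aA K2 by (simp add: v_def)
  then have v_range: "1 \<le> v j" "v j \<le> n" for j using A(1) by fastforce+
  have v_dist: "int (2 * h) \<le> \<bar>int (v j) - int (v l)\<bar> \<and> \<bar>int (v j) - int (v l)\<bar> \<le> int n - int (2 * h)"
    if "j < l" "l < k" for j l
  proof -
    have 1: "p (z j) + 2 * h \<le> p (z l)"
      using z_step[of j] pz_mono[of "Suc j" l] that(1) by simp
    \<comment> \<open>As the walk closes within one lap, the way from \<open>z l\<close> on to the
      copy of \<open>z j\<close> one lap later also has length at least
      \<open>2 * h\<close>.\<close>
    have "p (z k) \<le> p (i + K)" using i strict by (simp add: z_def strict_mono_less_eq)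
    then have "p (z k) \<le> p (z j) + n" using per pz_mono[of 0 j] by (simp add: z_def)
    then have 2: "p (z l) + 2 * h \<le> p (z j) + n"
      using z_step[of l] pz_mono[of "Suc l" k] that(2) by simp
    \<comment> \<open>The number of lap boundaries between the two points. It is 0 or 1, and the two
      cases exchange the roles of the arc and its complement.\<close>
    define q where "q = int (z l div K) - int (z j div K)"
    have eq: "int (p (z l)) - int (p (z j)) = int n * q + int (v l) - int (v j)"
      by (simp add: p_def v_def q_def algebra_simps)
    have "int n * q < int n * 2" using eq 2 v_range[of j] v_range[of l] assms(1) by linarith
    then have "q < 2" by (rule mult_left_less_imp_less) simp
    have "int n * (-1) < int n * q" using eq 1 v_range[of j] v_range[of l] assms(1) by linarith
    then have "-1 < q" by (rule mult_left_less_imp_less) simp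
    with \<open>q < 2\<close> consider "q = 0" | "q = 1" by linarith
    then show ?thesis
      using eq 1 2 by cases auto
  qed
  then have v_dist': "int (2 * h) \<le> \<bar>int (v j) - int (v l)\<bar> \<and> \<bar>int (v j) - int (v l)\<bar> \<le> int n - int (2 * h)"
    if "j \<noteq> l" "j < k" "l < k" for j l
    using that v_dist[of j l] v_dist[of l j] by (cases j l rule: linorder_cases) (simp_all add: abs_minus_commute)
  have "inj_on v {..<k}"
  proof (rule inj_onI)
    fix j l assume "j \<in> {..<k}" "l \<in> {..<k}" "v j = v l"
    then show "j = l" using v_dist'[of j l] assms(1) by auto
  qed
  then have "card (v ` {..<k}) = k" by (simp add: card_image)
  moreover have "v ` {..<k} \<subseteq> A" using vA by auto
  moreover have "s_stable (2 * h) n (v ` {..<k})"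
    unfolding s_stable_def
  proof (intro conjI ballI impI)
    show "v ` {..<k} \<noteq> {}" using assms(2) by auto
    show "v ` {..<k} \<subseteq> {1..n}" using v_range by auto
    fix x y assume "x \<in> v ` {..<k}" "y \<in> v ` {..<k}" "x \<noteq> y"
    then obtain j l where "x = v j" "y = v l" "j \<noteq> l" "j < k" "l < k" by auto
    then show "int (2 * h) \<le> \<bar>int x - int y\<bar>" "\<bar>int x - int y\<bar> \<le> int n - int (2 * h)"
      using v_dist' by blast+
  qed
  ultimately show ?thesis by blast
qed

text \<open>The entries at positions of one parity form a 2-stable set: entries of the other parity
  separate them, also across the point where the circle closes.\<close>

lemma stable_set_of_alternation:
  assumes "0 < h" "0 < k" and n: "(2 * h + 2) * k - 2 \<le> n"
    and xs: "sorted_wrt (<) xs" "set xs \<subseteq> {1..n}" "length xs = 2 * (h * (k - 1) + 1)"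
  shows "\<exists>S. s_stable (2 * h) n S \<and> card S = k \<and> S \<subseteq> {xs ! i | i. i < 2 * (h * (k - 1) + 1) \<and> even i = p}"
proof -
  define K where "K = h * (k - 1) + 1"
  let ?I = "{i. i < 2 * K \<and> even i = p}"
  let ?A = "(!) xs ` ?I"
  have len: "length xs = 2 * K" using xs(3) by (simp add: K_def)
  have less: "xs ! i < xs ! j" if "i < j" "j < 2 * K" for i j
    using sorted_wrt_nth_less[OF xs(1)] that len by simp
  have rng: "1 \<le> xs ! i" "xs ! i \<le> n" if "i < 2 * K" for i
  proof -
    have "xs ! i \<in> set xs" using that len by simp
    then have "xs ! i \<in> {1..n}" using xs(2) by blast
    then show "1 \<le> xs ! i" "xs ! i \<le> n" by simp_all
  qed
  have "?I = (\<lambda>j. 2 * j + (if p then 0 else 1)) ` {..<K}"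
  proof (intro equalityI subsetI)
    fix i assume "i \<in> ?I"
    then have "i = 2 * (i div 2) + (if p then 0 else 1)" "i div 2 < K" by (auto simp: odd_two_times_div_two_succ)
    then show "i \<in> (\<lambda>j. 2 * j + (if p then 0 else 1)) ` {..<K}" by blast
  qed (cases p; auto)
  then have "card ?I = K" by (simp add: card_image inj_on_def)
  moreover have "inj_on ((!) xs) ?I"
    using xs(1) len by (auto simp: strict_sorted_iff distinct_conv_nth inj_on_def)
  ultimately have "card ?A = h * (k - 1) + 1" by (simp add: card_image K_def)
  moreover have "?A \<subseteq> {1..n}" using rng by auto
  moreover have "x + 2 \<le> y \<and> y + 2 \<le> x + n" if xy: "x \<in> ?A" "y \<in> ?A" "x < y" for x y
  proof -
    obtain i j where i: "x = xs ! i" "i < 2 * K" "even i = p" and j: "y = xs ! j" "j < 2 * K" "even j = p"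
      using xy(1,2) by auto
    have "i < j"
    proof (rule ccontr)
      assume "\<not> i < j"
      then have "xs ! j \<le> xs ! i" using less[of j i] i(2) by (cases "i = j") auto
      then show False using xy(3) i(1) j(1) by simp
    qed
    have "Suc i \<noteq> j" using i(3) j(3) by auto
    then have "xs ! i < xs ! Suc i" "xs ! Suc i < xs ! j" using less \<open>i < j\<close> j(2) by simp_all
    then have 1: "x + 2 \<le> y" using i(1) j(1) by simp
    \<comment> \<open>The list has even length, so its first and last positions differ in parity. If
      \<open>x\<close> is the first entry, some entry follows \<open>y\<close>, so
      \<open>y < n\<close>; otherwise some entry precedes \<open>x\<close>, so
      \<open>x > 1\<close>.\<close>
    have 2: "y + 2 \<le> x + n"
    proof (cases i)
      case 0
      then have "even j" using i(3) j(3) by simp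
      then have "Suc j < 2 * K" using j(2) by presburger
      then have "y < n" using less[of j "Suc j"] rng(2)[of "Suc j"] j(1) by simp
      then show ?thesis using rng(1)[of i] i by simp
    next
      case (Suc i')
      then have "1 < x" using less[of i' i] rng(1)[of i'] i by simp
      then show ?thesis using rng(2)[of j] j by simp
    qed
    show ?thesis using 1 2 by simp
  qed
  ultimately obtain S where S: "S \<subseteq> ?A" "s_stable (2 * h) n S" "card S = k"
    using stable_subset_of_2_stable[OF assms(1,2) n, of ?A] by blast
  have "?A = {xs ! i | i. i < 2 * (h * (k - 1) + 1) \<and> even i = p}" unfolding K_def by auto
  with S show ?thesis by (intro exI[of _ S]) simp
qed

text \<open>Used to bound the colours when each stable set is coloured by its least element.\<close>

lemma separated_Min_Max:
  fixes A :: "nat set"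
  assumes "finite A" "A \<noteq> {}" "\<And>i j. i \<in> A \<Longrightarrow> j \<in> A \<Longrightarrow> i < j \<Longrightarrow> i + s \<le> j"
  shows "Min A + s * (card A - 1) \<le> Max A"
  using assms
proof (induction rule: finite_linorder_max_induct)
  case (insert b A)
  show ?case
  proof (cases "A = {}")
    case False
    have M: "Max A \<in> A" "Min A \<in> A" using insert.hyps(1) False by simp_all
    have ih: "Min A + s * (card A - 1) \<le> Max A" using insert False by auto
    have "Max A + s \<le> b" using insert.prems(2)[of "Max A" b] insert.hyps(2) M by simp
    moreover have "Max (insert b A) = b" using insert.hyps False by (intro Max_eqI) (auto intro: less_imp_le)
    moreover have "Min (insert b A) = Min A" 
      using insert.hyps(1,2) M(2) False by (simp add: min_absorb2 less_imp_le)
    moreover have "card (insert b A) - 1 = Suc (card A - 1)"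
    proof -
      have "b \<notin> A" using insert.hyps(2) by auto
      then show ?thesis using insert.hyps(1) False by (simp add: card_gt_0_iff)
    qed
    ultimately show ?thesis using ih by simp
  qed simp
qed simp

section \<open>The zigzag theorem\<close>

theorem theorem4:
  fixes n k s t :: nat
  assumes "0 < k" and "0 < n" and "0 < s" and "even s"
    and "n \<ge> (s + 2) * k - 2"
    and "t = n - s * (k - 1)"
  shows "(\<forall>c. proper_coloring (with_proj (stable_kneser_graph s n k)) c \<longrightarrow>
            (\<exists>A B. A \<inter> B = {} \<and> card A = t div 2 \<and> card B = (t + 1) div 2 \<and>
               subgraph (with_proj (biclique A B)) (with_proj (stable_kneser_graph s n k)) \<and>
               inj_on c (A \<union> B) \<and> alternating_parts t (c ` A) (c ` B)))
       \<and> chromatic_number (with_proj (stable_kneser_graph s n k)) = n - s * (k - 1)"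
proof -
  obtain h where h: "s = 2 * h" using \<open>even s\<close> by blast
  have h0: "0 < h" using h \<open>0 < s\<close> by simp
  let ?G = "stable_kneser_graph s n k"
  let ?V = "{S. s_stable s n S \<and> card S = k}"
  let ?M = "2 * (h * (k - 1) + 1)"
  have verts: "pverts ?G = ?V" and arcs: "parcs ?G = {(S, T). S \<in> ?V \<and> T \<in> ?V \<and> S \<inter> T = {}}"
    by (simp_all add: stable_kneser_graph_def Let_def)
  have finV: "finite ?V" by (rule finite_subset[of _ "Pow {1..n}"]) (auto simp: s_stable_def)
  have M: "?M = s * (k - 1) + 2" using h by simp
  have "(s + 2) * k = s * (k - 1) + s + 2 * k" using \<open>0 < k\<close> by (cases k) simp_all
  then have Mn: "?M \<le> n" using assms(5) \<open>0 < k\<close> h h0 unfolding M by linarith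
  then have t: "n - ?M + 2 = t" unfolding M \<open>t = _\<close> by linarith
  have zigzag: "\<exists>T. (\<forall>j<t. T j \<in> ?V) \<and> (\<forall>i<t. \<forall>j<t. even i \<noteq> even j \<longrightarrow> T i \<inter> T j = {}) \<and>
      (\<forall>i<t. \<forall>j<t. i < j \<longrightarrow> c (T i) < c (T j))"
    if c: "proper_coloring (with_proj ?G) c" for c
  proof -
    have proper: "c S \<noteq> c T" if "S \<in> ?V" "T \<in> ?V" "S \<inter> T = {}" for S T
    proof -
      have "(S, T) \<in> parcs ?G" unfolding arcs using that by blast
      then show ?thesis using c by (simp add: proper_coloring_def)
    qed
    have hit: "\<exists>S\<in>?V. S \<subseteq> {xs ! i | i. i < ?M \<and> even i = p}"
      if "sorted_wrt (<) xs" "set xs \<subseteq> {1..n}" "length xs = ?M" for xs p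
    proof -
      have "(2 * h + 2) * k - 2 \<le> n" using assms(5) unfolding h .
      from stable_set_of_alternation[OF h0 \<open>0 < k\<close> this that, of p]
      show ?thesis unfolding h by blast
    qed
    have M2: "2 \<le> ?M" by simp
    obtain T where T: "\<And>j. j < t \<Longrightarrow> T j \<in> ?V"
      "\<And>i j. i < t \<Longrightarrow> j < t \<Longrightarrow> even i \<noteq> even j \<Longrightarrow> T i \<inter> T j = {}"
      "\<And>j. Suc j < t \<Longrightarrow> c (T j) < c (T (Suc j))"
    proof (rule zigzag_of_alternating_hits[of ?V ?M n c, unfolded t])
      fix T :: "nat \<Rightarrow> nat set"
      assume "\<And>j. j < t \<Longrightarrow> T j \<in> ?V"
        "\<And>i j. i < t \<Longrightarrow> j < t \<Longrightarrow> even i \<noteq> even j \<Longrightarrow> T i \<inter> T j = {}"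
        "\<And>j. Suc j < t \<Longrightarrow> c (T j) < c (T (Suc j))"
      then show thesis by (rule that)
    qed (rule finV M2 Mn | erule (2) proper | erule (2) hit)+
    have "c (T i) < c (T j)" if "i < j" "j < t" for i j
      using that
    proof (induction j)
      case (Suc j)
      then show ?case using T(3)[of j] by (cases "i = j") (auto intro: less_trans)
    qed simp
    then show ?thesis using T(1,2) by blast
  qed
  have "\<exists>A B. A \<inter> B = {} \<and> card A = t div 2 \<and> card B = (t + 1) div 2 \<and>
               subgraph (with_proj (biclique A B)) (with_proj ?G) \<and>
               inj_on c (A \<union> B) \<and> alternating_parts t (c ` A) (c ` B)"
    if c: "proper_coloring (with_proj ?G) c" for c
  proof -
    obtain T where "(\<forall>j<t. T j \<in> ?V) \<and> (\<forall>i<t. \<forall>j<t. even i \<noteq> even j \<longrightarrow> T i \<inter> T j = {}) \<and>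
      (\<forall>i<t. \<forall>j<t. i < j \<longrightarrow> c (T i) < c (T j))"
      using zigzag[OF c] ..
    then have T: "\<forall>j<t. T j \<in> ?V" "\<forall>i<t. \<forall>j<t. even i \<noteq> even j \<longrightarrow> T i \<inter> T j = {}"
      "\<forall>i<t. \<forall>j<t. i < j \<longrightarrow> c (T i) < c (T j)" by - (elim conjE, assumption)+
    have injT: "inj_on (\<lambda>j. c (T j)) {..<t}"
      by (rule linorder_inj_onI') (use T(3) in fastforce)
    have injT': "inj_on T {..<t}" using injT by (auto simp: inj_on_def)
    \<comment> \<open>\<open>T\<close> is indexed from 0, so the odd indices below \<open>t\<close>
      are the smaller half, of size \<open>t div 2\<close>.\<close>
    define A where "A = T ` {j. j < t \<and> odd j}"
    define B where "B = T ` {j. j < t \<and> even j}"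
    have AB: "A \<union> B = T ` {..<t}" unfolding A_def B_def by auto
    have cards: "card {j. j < q \<and> odd j} = q div 2 \<and> card {j. j < q \<and> even j} = (q + 1) div 2" for q :: nat
    proof (induction q)
      case (Suc q)
      have "{j. j < Suc q \<and> odd j} = (if odd q then insert q {j. j < q \<and> odd j} else {j. j < q \<and> odd j})"
        "{j. j < Suc q \<and> even j} = (if even q then insert q {j. j < q \<and> even j} else {j. j < q \<and> even j})"
        by (auto simp: less_Suc_eq)
      then show ?case using Suc by auto
    qed simp
    have "card A = t div 2" "card B = (t + 1) div 2"
      unfolding A_def B_def using cards[of t]
      by (subst card_image[OF inj_on_subset[OF injT']]; auto)+
    moreover have "A \<inter> B = {}"
    proof -
      have "T ` ({j. j < t \<and> odd j} \<inter> {j. j < t \<and> even j}) = A \<inter> B"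
        unfolding A_def B_def by (rule inj_on_image_Int[OF injT']) auto
      moreover have "{j. j < t \<and> odd j} \<inter> {j. j < t \<and> even j} = {}" by auto
      ultimately show ?thesis by (metis image_empty)
    qed
    moreover have "subgraph (with_proj (biclique A B)) (with_proj ?G)"
    proof -
      have "A \<union> B \<subseteq> pverts ?G" unfolding AB verts using T(1) by blast
      moreover have "A \<times> B \<union> B \<times> A \<subseteq> parcs ?G"
        unfolding arcs A_def B_def using T(1,2) by fastforce
      moreover have "pair_wf_digraph (biclique A B)"
        by unfold_locales (auto simp: biclique_def)
      moreover have "pair_wf_digraph ?G"
        by unfold_locales (auto simp: stable_kneser_graph_def Let_def)
      ultimately show ?thesis
        by (simp add: subgraph_def compatible_def wf_digraph_wp_iff biclique_def)
    qed
    moreover have "inj_on c (A \<union> B)" unfolding AB using injT by (auto simp: inj_on_def)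
    moreover have "alternating_parts t (c ` A) (c ` B)"
    proof -
      \<comment> \<open>The enumeration of the colours starts at 1, which swaps parities: its odd
        positions give the colours of \<open>B\<close>.\<close>
      define e where "e j = c (T (j - 1))" for j
      have shift: "e ` {j \<in> {1..t}. Q (j - 1)} = c ` T ` {j. j < t \<and> Q j}" for Q
      proof -
        have "{j. j < t \<and> Q j} = (\<lambda>j. j - 1) ` {j \<in> {1..t}. Q (j - 1)}"
        proof (intro equalityI subsetI)
          fix j assume "j \<in> {j. j < t \<and> Q j}"
          then have "Suc j \<in> {j \<in> {1..t}. Q (j - 1)}" "j = Suc j - 1" by auto
          then show "j \<in> (\<lambda>j. j - 1) ` {j \<in> {1..t}. Q (j - 1)}" by blast
        qed auto
        then show ?thesis by (simp add: image_image e_def)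
      qed
      have "e ` {j \<in> {1..t}. odd j} = e ` {j \<in> {1..t}. even (j - 1)}" by (intro arg_cong[where f = "(`) e"]) auto
      also have "\<dots> = c ` B" unfolding B_def by (rule shift)
      finally have 1: "e ` {j \<in> {1..t}. odd j} = c ` B" .
      have "e ` {j \<in> {1..t}. even j} = e ` {j \<in> {1..t}. odd (j - 1)}" by (intro arg_cong[where f = "(`) e"]) auto
      also have "\<dots> = c ` A" unfolding A_def by (rule shift)
      finally have 2: "e ` {j \<in> {1..t}. even j} = c ` A" .
      have 3: "e ` {1..t} = c ` A \<union> c ` B" unfolding 1[symmetric] 2[symmetric] by auto
      have "strict_mono_on {1..t} e"
        by (rule strict_mono_onI) (use T(3) in \<open>simp add: e_def\<close>)
      then show ?thesis unfolding alternating_parts_def Let_def using 1 2 3 by blast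
    qed
    ultimately show ?thesis by blast
  qed
  moreover have "chromatic_number (with_proj ?G) = n - s * (k - 1)"
    unfolding chromatic_number_def
  proof (rule Least_equality)
    have V: "S \<noteq> {}" "finite S" "S \<subseteq> {1..n}" "Min S \<in> S" if "S \<in> ?V" for S
      using that finite_subset[of S "{1..n}"] by (auto simp: s_stable_def)
    \<comment> \<open>Upper bound: disjoint sets have different least elements, and a stable
      \<open>k\<close>-set leaves room for \<open>s * (k - 1)\<close> above its minimum.\<close>
    have "proper_coloring (with_proj ?G) Min"
      unfolding proper_coloring_def
    proof (intro conjI ballI allI impI)
      show "0 < Min v" if "v \<in> verts (with_proj ?G)" for v
        using V[of v] that verts by fastforce
      show "Min u \<noteq> Min v" if "u \<rightarrow>\<^bsub>with_proj ?G\<^esub> v" for u v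
      proof -
        have uv: "u \<in> ?V" "v \<in> ?V" "u \<inter> v = {}" using that arcs by auto
        then show ?thesis using V(4)[OF uv(1)] V(4)[OF uv(2)] by (metis disjoint_iff)
      qed
    qed
    moreover have "Min ` verts (with_proj ?G) \<subseteq> {1..n - s * (k - 1)}"
    proof clarify
      fix S assume "S \<in> verts (with_proj ?G)"
      then have S: "S \<in> ?V" using verts by simp
      have "i + s \<le> j" if "i \<in> S" "j \<in> S" "i < j" for i j
      proof -
        have "s_stable s n S" using S by simp
        moreover have "i \<noteq> j" using that(3) by simp
        ultimately have "int s \<le> \<bar>int i - int j\<bar>" using that(1,2) unfolding s_stable_def by blast
        then show ?thesis using that(3) by linarith
      qed
      then have "Min S + s * (card S - 1) \<le> Max S" using V[OF S] by (intro separated_Min_Max)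
      moreover have "Max S \<in> S" using V[OF S] by simp
      then have "Max S \<le> n" using V(3)[OF S] by auto
      ultimately have "Min S \<le> n - s * (k - 1)" using S by simp
      moreover have "1 \<le> Min S" using V(3,4)[OF S] by auto
      ultimately show "Min S \<in> {1..n - s * (k - 1)}" by simp
    qed
    ultimately show "\<exists>c. proper_coloring (with_proj ?G) c \<and> c ` verts (with_proj ?G) \<subseteq> {1..n - s * (k - 1)}"
      by blast
  next
    \<comment> \<open>Lower bound: any proper coloring has a zigzag, and its \<open>t\<close>
      colours are distinct.\<close>
    fix m assume "\<exists>c. proper_coloring (with_proj ?G) c \<and> c ` verts (with_proj ?G) \<subseteq> {1..m}"
    then obtain c where c: "proper_coloring (with_proj ?G) c" "c ` ?V \<subseteq> {1..m}" using verts by auto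
    obtain T where "(\<forall>j<t. T j \<in> ?V) \<and> (\<forall>i<t. \<forall>j<t. even i \<noteq> even j \<longrightarrow> T i \<inter> T j = {}) \<and>
      (\<forall>i<t. \<forall>j<t. i < j \<longrightarrow> c (T i) < c (T j))"
      using zigzag[OF c(1)] ..
    then have T: "\<forall>j<t. T j \<in> ?V" "\<forall>i<t. \<forall>j<t. i < j \<longrightarrow> c (T i) < c (T j)"
      by - (elim conjE, assumption)+
    have "inj_on (\<lambda>j. c (T j)) {..<t}"
      by (rule linorder_inj_onI') (use T(2) in fastforce)
    moreover have "(\<lambda>j. c (T j)) ` {..<t} \<subseteq> {1..m}" using T(1) c(2) by blast
    ultimately have "card {..<t} \<le> card {1..m}" by (intro card_inj_on_le) auto
    then show "n - s * (k - 1) \<le> m" using assms(6) by simp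
  qed
  ultimately show ?thesis by blast
qed

end
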